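(* Let $X_1,\dots,X_n$ be an independent sample from a distribution $P$ on $\mathbb{R}^p$, with $X_i=(X_{i1},\dots,X_{ip})^T$, and let $R_1,\dots,R_n$ be i.i.d. random vectors in $\{0,1\}^p$, with $R_i=(R_{i1},\dots,R_{ip})^T$, such that $(R_1,\dots,R_n)$ is independent of $(X_1,\dots,X_n)$ and $\Pr(R_1=(1,\dots,1)^T)>0$. Let $k\ge 1$ be an integer. Then for every matrix $\mathrm{M}=(\mu_{lj})\in\mathbb{R}^{k\times p}$, $$L^{(\mathrm{KPOD})}(\mathrm{M})=\sum_{r\in\{0,1\}^p}\Pr(R_1=r)\,L^{(\mathrm{KM})}(\mathrm{M}\mid r),$$ where $$L^{(\mathrm{KPOD})}(\mathrm{M})=E\Big[\min_{1\le l\le k}\sum_{j=1}^p R_{1j}(X_{1j}-\mu_{lj})^2\Big]$$ and, for $r=(r_1,\dots,r_p)^T\in\{0,1\}^p$, $$L^{(\mathrm{KM})}(\mathrm{M}\mid r)=E\Big[\min_{1\le l\le k}\sum_{j=1}^p r_j(X_{1j}-\mu_{lj})^2\Big].$$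
   Context: $R_{ij}=1$ means that the entry $X_{ij}$ is observed and $R_{ij}=0$ that it is missing (missing completely at random). The law of $R_1$ on $\{0,1\}^p$ is arbitrary apart from the stated positivity condition; the coordinates of $R_1$ need not be independent. $L^{(\mathrm{KPOD})}$ is the expected loss of the $k$-POD clustering, and $L^{(\mathrm{KM})}(\cdot\mid r)$ is the expected loss of the $k$-means clustering using only the dimensions $j$ with $r_j=1$. All expectations are of nonnegative random variables and are understood as elements of $[0,\infty]$, with the convention $0\cdot\infty=0$. *)

theory Defs
  imports "HOL-Probability.Probability"
begin

text \<open>The dimension \<open>p\<close> and the number of clusters \<open>k\<close> are the cardinalities of the
  finite index types \<open>'p\<close> and \<open>'k\<close>. A \<open>k \<times> p\<close> matrix of cluster centers has type
  \<open>real ^ 'p ^ 'k\<close>, so that \<open>\<mu> $ l\<close> is the \<open>l\<close>-th center.\<close>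

text \<open>The set \<open>{0,1}\<^sup>p\<close>, embedded in \<open>\<real>\<^sup>p\<close> so that its entries can be used as weights.\<close>

definition patterns :: "(real ^ 'p) set" where
  "patterns = {r. \<forall>j. r $ j \<in> {0, 1}}"

text \<open>Both losses are Lebesgue integrals in \<open>[0,\<infinity>]\<close>; no moments of \<open>X\<close> are assumed.\<close>

definition kpod_loss ::
    "'a measure \<Rightarrow> ('a \<Rightarrow> real ^ 'p) \<Rightarrow> ('a \<Rightarrow> real ^ 'p) \<Rightarrow> real ^ 'p ^ 'k \<Rightarrow> ennreal" where
  "kpod_loss \<Omega> X R \<mu> =
    (\<integral>\<^sup>+\<omega>. ennreal (MIN l. \<Sum>j\<in>UNIV. R \<omega> $ j * (X \<omega> $ j - \<mu> $ l $ j)\<^sup>2) \<partial>\<Omega>)"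

definition kmeans_loss ::
    "'a measure \<Rightarrow> ('a \<Rightarrow> real ^ 'p) \<Rightarrow> real ^ 'p ^ 'k \<Rightarrow> real ^ 'p \<Rightarrow> ennreal" where
  "kmeans_loss \<Omega> X \<mu> r =
    (\<integral>\<^sup>+\<omega>. ennreal (MIN l. \<Sum>j\<in>UNIV. r $ j * (X \<omega> $ j - \<mu> $ l $ j)\<^sup>2) \<partial>\<Omega>)"

text \<open>The sum over missingness patterns ranges over a finite set (an infinite index set
  would make it \<open>0\<close>).\<close>

lemma finite_patterns: "finite (patterns :: (real ^ 'p) set)"
proof -
  have "patterns \<subseteq> (\<lambda>f. (\<chi> j. f j) :: real ^ 'p) ` (UNIV \<rightarrow>\<^sub>E {0, 1})"
  proof
    fix r :: "real ^ 'p"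
    assume "r \<in> patterns"
    then have "($) r \<in> UNIV \<rightarrow>\<^sub>E {0, 1}"
      by (auto simp: patterns_def)
    then have "(\<chi> j. r $ j) \<in> (\<lambda>f. (\<chi> j. f j) :: real ^ 'p) ` (UNIV \<rightarrow>\<^sub>E {0, 1})"
      by (rule imageI)
    then show "r \<in> (\<lambda>f. (\<chi> j. f j) :: real ^ 'p) ` (UNIV \<rightarrow>\<^sub>E {0, 1})"
      by simp
  qed
  then show ?thesis
    by (rule finite_subset) (intro finite_imageI finite_PiE, auto)
qed

end

theory Submission
  imports Defs
begin

text \<open>
  The losses share the integrand \<open>g r x = min\<^sub>l \<Sum>\<^sub>j r\<^sub>j (x\<^sub>j - \<mu>\<^sub>l\<^sub>j)\<^sup>2\<close>: the \<open>k\<close>-POD loss is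
  \<open>E g (R\<^sub>1, X\<^sub>1)\<close> and the \<open>k\<close>-means loss at a pattern \<open>r\<close> is \<open>E g (r, X\<^sub>1)\<close>. Since \<open>R\<^sub>1\<close> and
  \<open>X\<^sub>1\<close> are independent, conditioning on \<open>R\<^sub>1 = r\<close> does not change the law of \<open>X\<^sub>1\<close>, so the claim
  is the law of total expectation over the finitely many values of \<open>R\<^sub>1\<close>. That law holds for
  every nonnegative integrand with measurable sections (\<open>nn_integral_indep_finite_valued\<close>); a
  section \<open>g r\<close> is a minimum of finitely many polynomials, hence Borel. Independence of the single
  pair \<open>(R\<^sub>1, X\<^sub>1)\<close> comes from the independence of the two samples by projecting each to its first
  coordinate.
\<close>

text \<open>
  By independence the joint law of \<open>(R, X)\<close> is a product, so Tonelli's theorem integrates out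
  \<open>X\<close> first. Finiteness of \<open>S\<close> enters twice: measurability of each section \<open>f r\<close> gives joint
  measurability, and the remaining integral over \<open>R\<close> is a finite sum.
\<close>

lemma (in prob_space) nn_integral_indep_finite_valued:
  assumes indep: "indep_var (count_space S) R N X"
    and fin: "finite S"
    and f: "\<And>r. r \<in> S \<Longrightarrow> f r \<in> borel_measurable N"
  shows "(\<integral>\<^sup>+\<omega>. f (R \<omega>) (X \<omega>) \<partial>M) =
    (\<Sum>r\<in>S. ennreal (prob {\<omega> \<in> space M. R \<omega> = r}) * (\<integral>\<^sup>+\<omega>. f r (X \<omega>) \<partial>M))"
proof -
  have [measurable]: "R \<in> measurable M (count_space S)" "X \<in> measurable M N"
    using indep by (auto dest: indep_var_rv1 indep_var_rv2)
  have f_joint [measurable]: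
      "(\<lambda>(r, x). f r x) \<in> borel_measurable (count_space S \<Otimes>\<^sub>M N)"
    using fin f by (intro measurable_pair_measure_countable1) (auto simp: countable_finite)
  interpret X: prob_space "distr M N X"
    by (rule prob_space_distr) simp
  define h where "h r = (\<integral>\<^sup>+\<omega>. f r (X \<omega>) \<partial>M)" for r
  have "(\<integral>\<^sup>+\<omega>. f (R \<omega>) (X \<omega>) \<partial>M) =
      (\<integral>\<^sup>+z. (case z of (r, x) \<Rightarrow> f r x) \<partial>distr M (count_space S \<Otimes>\<^sub>M N) (\<lambda>\<omega>. (R \<omega>, X \<omega>)))"
    by (subst nn_integral_distr) auto
  also have "\<dots> = (\<integral>\<^sup>+z. (case z of (r, x) \<Rightarrow> f r x) \<partial>(distr M (count_space S) R \<Otimes>\<^sub>M distr M N X))"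
    using indep by (simp add: indep_var_distribution_eq)
  also have "\<dots> = (\<integral>\<^sup>+r. \<integral>\<^sup>+x. f r x \<partial>distr M N X \<partial>distr M (count_space S) R)"
    by (subst X.nn_integral_fst[symmetric]) auto
  also have "\<dots> = (\<integral>\<^sup>+r. h r \<partial>distr M (count_space S) R)"
    by (intro nn_integral_cong) (auto simp: h_def f nn_integral_distr)
  also have "\<dots> = (\<integral>\<^sup>+\<omega>. h (R \<omega>) \<partial>M)"
    by (subst nn_integral_distr) auto
  also have "\<dots> = (\<integral>\<^sup>+\<omega>. (\<Sum>r\<in>S. h r * indicator {\<omega> \<in> space M. R \<omega> = r} \<omega>) \<partial>M)"
  proof (intro nn_integral_cong)
    fix \<omega> assume \<omega>: "\<omega> \<in> space M"
    then have "R \<omega> \<in> S"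
      using measurable_space[of R M "count_space S" \<omega>] by simp
    have "(\<Sum>r\<in>S. h r * indicator {\<omega> \<in> space M. R \<omega> = r} \<omega>) = (\<Sum>r\<in>S. if R \<omega> = r then h r else 0)"
      using \<omega> by (intro sum.cong) (auto simp: indicator_def)
    also have "\<dots> = h (R \<omega>)"
      using fin \<open>R \<omega> \<in> S\<close> by simp
    finally show "h (R \<omega>) = (\<Sum>r\<in>S. h r * indicator {\<omega> \<in> space M. R \<omega> = r} \<omega>)"
      by simp
  qed
  also have "\<dots> = (\<Sum>r\<in>S. h r * emeasure M {\<omega> \<in> space M. R \<omega> = r})"
  proof -
    have "{\<omega> \<in> space M. R \<omega> = r} \<in> events" if "r \<in> S" for r
      using that by measurable
    then show ?thesis
      by (subst nn_integral_sum) (auto simp: nn_integral_cmult_indicator)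
  qed
  finally show ?thesis
    by (simp add: h_def emeasure_eq_measure mult.commute)
qed

theorem proposition2p1:
  fixes \<Omega> :: "'a measure"
    and n :: nat
    and P :: "(real ^ 'p) measure"
    and X R :: "nat \<Rightarrow> 'a \<Rightarrow> real ^ 'p"
    and \<mu> :: "real ^ 'p ^ 'k"
  assumes "prob_space \<Omega>"
    and "n \<ge> 1"
    and "prob_space P" and "sets P = sets borel"
    and "prob_space.indep_vars \<Omega> (\<lambda>_. borel) X {1..n}"
    and "\<And>i. i \<in> {1..n} \<Longrightarrow> distr \<Omega> borel (X i) = P"
    and "prob_space.indep_vars \<Omega> (\<lambda>_. count_space patterns) R {1..n}"
    and "\<And>i. i \<in> {1..n} \<Longrightarrow>
      distr \<Omega> (count_space patterns) (R i) = distr \<Omega> (count_space patterns) (R 1)"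
    and "prob_space.indep_var \<Omega>
      (\<Pi>\<^sub>M i\<in>{1..n}. count_space patterns) (\<lambda>\<omega>. \<lambda>i\<in>{1..n}. R i \<omega>)
      (\<Pi>\<^sub>M i\<in>{1..n}. borel) (\<lambda>\<omega>. \<lambda>i\<in>{1..n}. X i \<omega>)"
    and "measure \<Omega> {\<omega> \<in> space \<Omega>. R 1 \<omega> = (\<chi> j. 1)} > 0"
  shows "kpod_loss \<Omega> (X 1) (R 1) \<mu> =
    (\<Sum>r\<in>patterns. ennreal (measure \<Omega> {\<omega> \<in> space \<Omega>. R 1 \<omega> = r}) * kmeans_loss \<Omega> (X 1) \<mu> r)"
proof -
  interpret prob_space \<Omega> by fact
  have 1: "1 \<in> {1..n}"
    using \<open>n \<ge> 1\<close> by simp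
  have "indep_var
      (count_space patterns) ((\<lambda>x. x 1) \<circ> (\<lambda>\<omega>. \<lambda>i\<in>{1..n}. R i \<omega>))
      borel ((\<lambda>x. x 1) \<circ> (\<lambda>\<omega>. \<lambda>i\<in>{1..n}. X i \<omega>))"
    by (rule indep_var_compose[OF assms(9)]) (rule measurable_component_singleton[OF 1])+
  then have indep: "indep_var (count_space patterns) (R 1) borel (X 1)"
    using 1 by (simp add: comp_def)
  have "(\<lambda>x. ennreal (MIN l. \<Sum>j\<in>UNIV. r $ j * (x $ j - \<mu> $ l $ j)\<^sup>2)) \<in> borel_measurable borel"
    for r :: "real ^ 'p"
    by (intro measurable_compose[OF _ measurable_ennreal] borel_measurable_Min)
      (auto intro!: borel_measurable_continuous_onI continuous_intros)
  from nn_integral_indep_finite_valued[OF indep finite_patterns this] show ?thesis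
    by (simp add: kpod_loss_def kmeans_loss_def)
qed

end
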